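(* Suppose $\{g_{S}: S\in\mathrm{Tab}_\tau\}$ satisfies property (SP), with singular value $\kappa_0$. Let $\rho:\mathcal P_\tau\to\mathcal P$ be the linear map $\rho\left(\sum_{S} f_S(x)\otimes S\right)=\sum_{S} f_S(x)g_S(x)$. Then, for the parameter value $\kappa=\kappa_0$, the map $\rho$ intertwines $\mathbf D_i$, $\mathbf U_i$ with $\mathcal D_i$, $\mathcal U_i$ respectively: $\mathbf D_i\,\rho=\rho\,\mathcal D_i$ and $\mathbf U_i\,\rho=\rho\,\mathcal U_i$ for $1\le i\le N$ (operators act on the right).
   Context: Tableaux. Let $N\ge 2$ and let $\tau$ be a partition of $N$. Its Ferrers diagram is the set of boxes $(i,j)$ (row $i$, column $j$), $1\le i\le \ell(\tau)$, $1\le j\le\tau_i$. $\mathrm{Tab}_\tau$ is the set of reverse standard Young tableaux of shape $\tau$: fillings of the boxes by $1,\dots,N$, each used once, decreasing along each row (as $j$ increases) and along each column (as $i$ increases). For $S\in\mathrm{Tab}_\tau$ the entry $k$ is in box $(\mathrm{row}_S[k],\mathrm{col}_S[k])$ and its content is $c_S[k]=\mathrm{col}_S[k]-\mathrm{row}_S[k]$. $S^{(i)}$ is the tableau obtained from $S$ by exchanging $i$ and $i+1$. Let $\mathbb F$ be an extension field of $\mathbb C$ and $V_\tau$ the $\mathbb F$-vector space with basis $\mathrm{Tab}_\tau$. All operators act on the right. The representation $\tau$ of $\mathcal S_N$ on $V_\tau$ is given, for $s_i=(i,i+1)$ and $b=c_S[i]-c_S[i+1]$, by: (I) if $\mathrm{row}_S[i]=\mathrm{row}_S[i+1]$,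 $S\tau(s_i)=S$; (II) if $\mathrm{col}_S[i]=\mathrm{col}_S[i+1]$, $S\tau(s_i)=-S$; (III) if $\mathrm{row}_S[i]<\mathrm{row}_S[i+1]$ and $\mathrm{col}_S[i]>\mathrm{col}_S[i+1]$, $S\tau(s_i)=S^{(i)}+\frac1b S$; (IV) if $b\le -2$, $S\tau(s_i)=\left(1-\frac1{b^2}\right)S^{(i)}+\frac1b S$. $\mathcal P=\mathbb F[x_1,\dots,x_N]$ with the right action of $\mathcal S_N$ in which $s_i$ exchanges $x_i$ and $x_{i+1}$; $s_{ij}$ is the transposition $(i,j)$. $\mathcal P_\tau=\mathcal P\otimes V_\tau$. For a parameter $\kappa$: $f\partial_{ij}=\frac{f-fs_{ij}}{x_i-x_j}$; Dunkl operators $f\mathcal D_i=\frac{\partial f}{\partial x_i}+\kappa\sum_{j\ne i}f\partial_{ij}$; Jucys–Murphy elements $\omega_i=\sum_{j>i}s_{ij}$; Cherednik operators $f\,\mathcal U_i=x_i(f\mathcal D_i)+f+\kappa f\omega_i$. Vector-valued versions on $\mathcal P_\tau$: $(f\otimes S)\mathbf D_i=\frac{\partial f}{\partial x_i}\otimes S+\kappa\sum_{j\ne i}f\partial_{ij}\otimes S\tau(s_{ij})$; $(f\otimes S)\mathbf w_i=\sum_{j>i}fs_{ij}\otimes S\tau(s_{ij})$; $p\,\mathbf U_i=x_i(p\mathbf D_i)+p+\kappa\, p\mathbf w_i$, where multiplication by $x_i$ acts on the polynomial factor. A basis $\{g_S\}$ of an $\mathcal S_N$-invariant space of polynomials is a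 basis for a space of polynomials of isotype $\tau$ for $\mathcal S_N$ if each $g_Ss_i$ is given by (I)–(IV) with $S$, $S^{(i)}$ replaced by $g_S$, $g_{S^{(i)}}$. A polynomial $p$ with rational coefficients is singular for $\kappa=\kappa_0$ ($\kappa_0$ rational) if $p\mathcal D_i=0$ for all $1\le i\le N$ when $\kappa=\kappa_0$. Property (SP): $\{g_S:S\in\mathrm{Tab}_\tau\}$ is a basis for a space of polynomials of isotype $\tau$ for $\mathcal S_N$ and every $g_S$ is singular, all with the same $\kappa=\kappa_0$. *)

theory Defs
  imports Complex_Main "HOL-Library.Poly_Mapping" "HOL-Combinatorics.Permutations"
begin

section \<open>Reverse standard Young tableaux\<close>

definition is_partition :: "nat \<Rightarrow> nat list \<Rightarrow> bool" where
  "is_partition N tau \<longleftrightarrow> sorted_wrt (\<ge>) tau \<and> (\<forall>k\<in>set tau. 1 \<le> k) \<and> sum_list tau = N"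

text \<open>Boxes are pairs (row, column), both counted from 1.\<close>

definition boxes :: "nat list \<Rightarrow> (nat \<times> nat) set" where
  "boxes tau = {(i, j). 1 \<le> i \<and> i \<le> length tau \<and> 1 \<le> j \<and> j \<le> tau ! (i - 1)}"

type_synonym tableau = "nat \<times> nat \<Rightarrow> nat"

text \<open>A filling takes the dummy value 0 outside the diagram, so that two tableaux of the same
  shape are equal as functions iff they have the same entries.\<close>

definition Tab :: "nat \<Rightarrow> nat list \<Rightarrow> tableau set" where
  "Tab N tau = {S. bij_betw S (boxes tau) {1..N} \<and> (\<forall>x. x \<notin> boxes tau \<longrightarrow> S x = 0) \<and>
     (\<forall>i j j'. (i, j) \<in> boxes tau \<and> (i, j') \<in> boxes tau \<and> j < j' \<longrightarrow> S (i, j) > S (i, j')) \<and>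
     (\<forall>i i' j. (i, j) \<in> boxes tau \<and> (i', j) \<in> boxes tau \<and> i < i' \<longrightarrow> S (i, j) > S (i', j))}"

definition box_of :: "nat list \<Rightarrow> tableau \<Rightarrow> nat \<Rightarrow> nat \<times> nat" where
  "box_of tau S k = (THE x. x \<in> boxes tau \<and> S x = k)"

definition row :: "nat list \<Rightarrow> tableau \<Rightarrow> nat \<Rightarrow> nat" where
  "row tau S k = fst (box_of tau S k)"

definition col :: "nat list \<Rightarrow> tableau \<Rightarrow> nat \<Rightarrow> nat" where
  "col tau S k = snd (box_of tau S k)"

definition content :: "nat list \<Rightarrow> tableau \<Rightarrow> nat \<Rightarrow> int" where
  "content tau S k = int (col tau S k) - int (row tau S k)"

definition exchange :: "nat \<Rightarrow> tableau \<Rightarrow> tableau" where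
  "exchange i S = transpose i (i + 1) \<circ> S"

text \<open>The formulas (I)--(IV) for \<open>s\<^sub>i = (i, i + 1)\<close>, shared by the representation on \<open>V\<^sub>\<tau>\<close> and by
  the bases of isotype \<open>\<tau>\<close>: \<open>e\<close> is the family indexed by tableaux, \<open>scale\<close> the scalar
  multiplication and \<open>act i\<close> the (right) action of \<open>s\<^sub>i\<close>. The exchanged filling in (III) and (IV)
  is again a reverse standard tableau.\<close>

definition seminormal_action ::
  "nat \<Rightarrow> nat list \<Rightarrow> ('f::field_char_0 \<Rightarrow> 'v::ab_group_add \<Rightarrow> 'v) \<Rightarrow> (tableau \<Rightarrow> 'v) \<Rightarrow>
    (nat \<Rightarrow> 'v \<Rightarrow> 'v) \<Rightarrow> bool" where
  "seminormal_action N tau scale e act \<longleftrightarrow>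
     (\<forall>S\<in>Tab N tau. \<forall>i. 1 \<le> i \<and> i < N \<longrightarrow>
       (let b = content tau S i - content tau S (i + 1) in
         (row tau S i = row tau S (i + 1) \<longrightarrow> act i (e S) = e S) \<and>
         (col tau S i = col tau S (i + 1) \<longrightarrow> act i (e S) = - e S) \<and>
         (row tau S i < row tau S (i + 1) \<and> col tau S i > col tau S (i + 1) \<longrightarrow>
            act i (e S) = e (exchange i S) + scale (1 / of_int b) (e S)) \<and>
         (b \<le> - 2 \<longrightarrow>
            act i (e S) = scale (1 - 1 / (of_int b)^2) (e (exchange i S))
                          + scale (1 / of_int b) (e S))))"


section \<open>Polynomials\<close>

text \<open>Polynomials over \<open>'f\<close> in variables \<open>x\<^sub>0, x\<^sub>1, \<dots>\<close>, as finitely supported maps from exponent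
  vectors to coefficients; multiplication is the convolution product of \<open>Poly_Mapping\<close>.
  \<open>Pol N\<close> is the subring of polynomials in \<open>x\<^sub>1, \<dots>, x\<^sub>N\<close>.\<close>

type_synonym 'f mpoly = "(nat \<Rightarrow>\<^sub>0 nat) \<Rightarrow>\<^sub>0 'f"

definition X :: "nat \<Rightarrow> 'f::field_char_0 mpoly" where
  "X i = Poly_Mapping.single (Poly_Mapping.single i 1) 1"

definition Const :: "'f::field_char_0 \<Rightarrow> 'f mpoly" where
  "Const c = Poly_Mapping.single 0 c"

definition Pol :: "nat \<Rightarrow> 'f::field_char_0 mpoly set" where
  "Pol N = {p. \<forall>m\<in>Poly_Mapping.keys p. Poly_Mapping.keys m \<subseteq> {1..N}}"

definition rational_coeffs :: "'f::field_char_0 mpoly \<Rightarrow> bool" where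
  "rational_coeffs p \<longleftrightarrow> (\<forall>m. Poly_Mapping.lookup p m \<in> \<rat>)"

text \<open>Multiplication of all coefficients of a finitely supported map by a ring element. This is
  the scalar multiplication of \<open>V\<^sub>\<tau>\<close> and of the polynomial ring, and, with a polynomial as
  multiplier, multiplication on the polynomial factor of \<open>P\<^sub>\<tau>\<close>.\<close>

definition pm_scale :: "'c::comm_ring_1 \<Rightarrow> ('k \<Rightarrow>\<^sub>0 'c) \<Rightarrow> ('k \<Rightarrow>\<^sub>0 'c)"  (infixr "\<odot>" 75) where
  "c \<odot> v = Poly_Mapping.map (\<lambda>a. c * a) v"

text \<open>The right action of a permutation \<open>w\<close>, which substitutes \<open>x\<^bsub>w i\<^esub>\<close> for \<open>x\<^sub>i\<close>: the
  coefficient of \<open>perm_act w p\<close> at the exponent vector \<open>m\<close> is that of \<open>p\<close> at \<open>m \<circ> w\<close>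
  (\<open>w\<close> has to be injective for \<open>Poly_Mapping.map_key\<close> to be meaningful).\<close>

definition perm_act :: "(nat \<Rightarrow> nat) \<Rightarrow> 'f::field_char_0 mpoly \<Rightarrow> 'f mpoly" where
  "perm_act w p = Poly_Mapping.map_key (Poly_Mapping.map_key w) p"

lemma perm_act_X:
  assumes "bij w"
  shows "perm_act w (X i) = X (w i)"
proof -
  have inj: "inj w" using assms by (rule bij_is_inj)
  have key: "Poly_Mapping.map_key w (Poly_Mapping.single (w i) (1::nat)) = Poly_Mapping.single i 1"
    using inj by (rule map_key_single)
  have "inj (Poly_Mapping.map_key w :: (nat \<Rightarrow>\<^sub>0 nat) \<Rightarrow> (nat \<Rightarrow>\<^sub>0 nat))"
  proof (rule injI)
    fix m m' :: "nat \<Rightarrow>\<^sub>0 nat"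
    assume eq: "Poly_Mapping.map_key w m = Poly_Mapping.map_key w m'"
    have "Poly_Mapping.lookup m (w k) = Poly_Mapping.lookup m' (w k)" for k
      using arg_cong[OF eq, of "\<lambda>u. Poly_Mapping.lookup u k"] inj
      by (simp add: map_key.rep_eq)
    then show "m = m'"
      by (intro poly_mapping_eqI) (metis assms bij_pointE)
  qed
  then show ?thesis
    unfolding perm_act_def X_def key[symmetric] by (rule map_key_single)
qed

definition pdiff :: "nat \<Rightarrow> 'f::field_char_0 mpoly \<Rightarrow> 'f mpoly" where
  "pdiff i f = (\<Sum>m\<in>Poly_Mapping.keys f.
     Poly_Mapping.single (m - Poly_Mapping.single i 1)
       (of_nat (Poly_Mapping.lookup m i) * Poly_Mapping.lookup f m))"

text \<open>\<open>(f - f s\<^sub>i\<^sub>j) / (x\<^sub>i - x\<^sub>j)\<close>: the division is exact, and the quotient is unique because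
  polynomials form an integral domain.\<close>

definition divdiff :: "nat \<Rightarrow> nat \<Rightarrow> 'f::field_char_0 mpoly \<Rightarrow> 'f mpoly" where
  "divdiff i j f = (THE q. (X i - X j) * q = f - perm_act (transpose i j) f)"

definition dunkl :: "nat \<Rightarrow> 'f::field_char_0 \<Rightarrow> nat \<Rightarrow> 'f mpoly \<Rightarrow> 'f mpoly" where
  "dunkl N \<kappa> i f = pdiff i f + \<kappa> \<odot> (\<Sum>j\<in>{1..N} - {i}. divdiff i j f)"

definition jucys_murphy :: "nat \<Rightarrow> nat \<Rightarrow> 'f::field_char_0 mpoly \<Rightarrow> 'f mpoly" where
  "jucys_murphy N i f = (\<Sum>j\<in>{i<..N}. perm_act (transpose i j) f)"

definition cherednik :: "nat \<Rightarrow> 'f::field_char_0 \<Rightarrow> nat \<Rightarrow> 'f mpoly \<Rightarrow> 'f mpoly" where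
  "cherednik N \<kappa> i f = X i * dunkl N \<kappa> i f + f + \<kappa> \<odot> jucys_murphy N i f"


section \<open>The representation on \<open>V\<^sub>\<tau>\<close> and vector-valued polynomials\<close>

definition V :: "nat \<Rightarrow> nat list \<Rightarrow> (tableau \<Rightarrow>\<^sub>0 'f::field_char_0) set" where
  "V N tau = {v. Poly_Mapping.keys v \<subseteq> Tab N tau}"

abbreviation tab_basis :: "tableau \<Rightarrow> (tableau \<Rightarrow>\<^sub>0 'f::field_char_0)" where
  "tab_basis S \<equiv> Poly_Mapping.single S 1"

text \<open>\<open>R w\<close> is the operator \<open>\<tau>(w)\<close>. Operators act on the right, so the product in which \<open>\<sigma>\<close> acts
  first and \<open>\<pi>\<close> second is the function \<open>\<pi> \<circ> \<sigma>\<close>; this agrees with \<open>perm_act\<close>. Since the \<open>s\<^sub>i\<close>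
  generate the symmetric group, these conditions determine \<open>R w\<close> on \<open>V N tau\<close> for
  every permutation \<open>w\<close> of \<open>{1..N}\<close>.\<close>

definition young_rep ::
  "nat \<Rightarrow> nat list \<Rightarrow> ((nat \<Rightarrow> nat) \<Rightarrow> (tableau \<Rightarrow>\<^sub>0 'f::field_char_0) \<Rightarrow> (tableau \<Rightarrow>\<^sub>0 'f)) \<Rightarrow> bool" where
  "young_rep N tau R \<longleftrightarrow>
     (\<forall>w. w permutes {1..N} \<longrightarrow>
        (\<forall>v\<in>V N tau. R w v \<in> V N tau) \<and>
        (\<forall>u\<in>V N tau. \<forall>v\<in>V N tau. R w (u + v) = R w u + R w v) \<and>
        (\<forall>c. \<forall>v\<in>V N tau. R w (c \<odot> v) = c \<odot> R w v)) \<and>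
     (\<forall>v\<in>V N tau. R id v = v) \<and>
     (\<forall>\<sigma> \<pi>. \<sigma> permutes {1..N} \<and> \<pi> permutes {1..N} \<longrightarrow>
        (\<forall>v\<in>V N tau. R (\<pi> \<circ> \<sigma>) v = R \<pi> (R \<sigma> v))) \<and>
     seminormal_action N tau pm_scale tab_basis (\<lambda>i. R (transpose i (i + 1)))"

text \<open>An element \<open>\<Sum>\<^sub>S f\<^sub>S \<otimes> S\<close> of \<open>P\<^sub>\<tau> = P \<otimes> V\<^sub>\<tau>\<close> is represented by its coefficient family
  \<open>S \<mapsto> f\<^sub>S\<close>.\<close>

type_synonym 'f vpoly = "tableau \<Rightarrow>\<^sub>0 'f mpoly"

definition Pol_tau :: "nat \<Rightarrow> nat list \<Rightarrow> 'f::field_char_0 vpoly set" where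
  "Pol_tau N tau = {p. Poly_Mapping.keys p \<subseteq> Tab N tau \<and> (\<forall>S. Poly_Mapping.lookup p S \<in> Pol N)}"

definition tensor :: "'f::field_char_0 mpoly \<Rightarrow> (tableau \<Rightarrow>\<^sub>0 'f) \<Rightarrow> 'f vpoly" where
  "tensor f v = Poly_Mapping.map (\<lambda>c. c \<odot> f) v"

text \<open>The additive extension to \<open>P\<^sub>\<tau>\<close> of a map given on the tensors \<open>f \<otimes> S\<close>.\<close>

definition extend ::
  "('f::field_char_0 mpoly \<Rightarrow> tableau \<Rightarrow> 'b::comm_monoid_add) \<Rightarrow> 'f vpoly \<Rightarrow> 'b" where
  "extend F p = (\<Sum>S\<in>Poly_Mapping.keys p. F (Poly_Mapping.lookup p S) S)"

definition vdunkl ::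
  "((nat \<Rightarrow> nat) \<Rightarrow> (tableau \<Rightarrow>\<^sub>0 'f::field_char_0) \<Rightarrow> (tableau \<Rightarrow>\<^sub>0 'f)) \<Rightarrow> nat \<Rightarrow> 'f \<Rightarrow> nat \<Rightarrow>
    'f vpoly \<Rightarrow> 'f vpoly" where
  "vdunkl R N \<kappa> i = extend (\<lambda>f S. tensor (pdiff i f) (tab_basis S) +
     Const \<kappa> \<odot> (\<Sum>j\<in>{1..N} - {i}. tensor (divdiff i j f) (R (transpose i j) (tab_basis S))))"

definition vjucys_murphy ::
  "((nat \<Rightarrow> nat) \<Rightarrow> (tableau \<Rightarrow>\<^sub>0 'f::field_char_0) \<Rightarrow> (tableau \<Rightarrow>\<^sub>0 'f)) \<Rightarrow> nat \<Rightarrow> nat \<Rightarrow>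
    'f vpoly \<Rightarrow> 'f vpoly" where
  "vjucys_murphy R N i = extend (\<lambda>f S.
     \<Sum>j\<in>{i<..N}. tensor (perm_act (transpose i j) f) (R (transpose i j) (tab_basis S)))"

definition vcherednik ::
  "((nat \<Rightarrow> nat) \<Rightarrow> (tableau \<Rightarrow>\<^sub>0 'f::field_char_0) \<Rightarrow> (tableau \<Rightarrow>\<^sub>0 'f)) \<Rightarrow> nat \<Rightarrow> 'f \<Rightarrow> nat \<Rightarrow>
    'f vpoly \<Rightarrow> 'f vpoly" where
  "vcherednik R N \<kappa> i p = X i \<odot> vdunkl R N \<kappa> i p + p + Const \<kappa> \<odot> vjucys_murphy R N i p"


section \<open>Singular polynomials of isotype \<open>\<tau>\<close>\<close>

text \<open>Linear independence and span are over the field \<open>'f\<close>.\<close>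

definition isotype_basis :: "nat \<Rightarrow> nat list \<Rightarrow> (tableau \<Rightarrow> 'f::field_char_0 mpoly) \<Rightarrow> bool" where
  "isotype_basis N tau g \<longleftrightarrow>
     (\<forall>S\<in>Tab N tau. g S \<in> Pol N) \<and>
     inj_on g (Tab N tau) \<and>
     \<not> module.dependent (pm_scale :: 'f \<Rightarrow> 'f mpoly \<Rightarrow> 'f mpoly) (g ` Tab N tau) \<and>
     (\<forall>w. w permutes {1..N} \<longrightarrow>
        perm_act w ` module.span pm_scale (g ` Tab N tau) \<subseteq> module.span pm_scale (g ` Tab N tau)) \<and>
     seminormal_action N tau pm_scale g (\<lambda>i. perm_act (transpose i (i + 1)))"

definition singular :: "nat \<Rightarrow> rat \<Rightarrow> 'f::field_char_0 mpoly \<Rightarrow> bool" where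
  "singular N \<kappa>\<^sub>0 p \<longleftrightarrow> p \<in> Pol N \<and> rational_coeffs p \<and> (\<forall>i\<in>{1..N}. dunkl N (of_rat \<kappa>\<^sub>0) i p = 0)"

definition property_SP :: "nat \<Rightarrow> nat list \<Rightarrow> rat \<Rightarrow> (tableau \<Rightarrow> 'f::field_char_0 mpoly) \<Rightarrow> bool" where
  "property_SP N tau \<kappa>\<^sub>0 g \<longleftrightarrow> isotype_basis N tau g \<and> (\<forall>S\<in>Tab N tau. singular N \<kappa>\<^sub>0 (g S))"

definition rho :: "(tableau \<Rightarrow> 'f::field_char_0 mpoly) \<Rightarrow> 'f vpoly \<Rightarrow> 'f mpoly" where
  "rho g = extend (\<lambda>f S. f * g S)"

text \<open>A ring homomorphism from \<open>\<complex>\<close>, exhibiting the field \<open>'f\<close> as an extension field of \<open>\<complex>\<close>.\<close>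

definition complex_embedding :: "(complex \<Rightarrow> 'f::field_char_0) \<Rightarrow> bool" where
  "complex_embedding \<iota> \<longleftrightarrow> \<iota> 1 = 1 \<and> (\<forall>x y. \<iota> (x + y) = \<iota> x + \<iota> y) \<and> (\<forall>x y. \<iota> (x * y) = \<iota> x * \<iota> y)"

end

theory Submission
  imports Defs
begin

text \<open>The Leibniz rules for \<open>\<partial>/\<partial>x\<^sub>i\<close> and \<open>\<partial>\<^sub>i\<^sub>j\<close> give
  \<open>(f g) D\<^sub>i = (\<partial>f/\<partial>x\<^sub>i) g + \<kappa> \<Sum>\<^sub>j (f \<partial>\<^sub>i\<^sub>j) (g s\<^sub>i\<^sub>j) + f (g D\<^sub>i)\<close>, and the last term vanishes when
  \<open>g = g\<^sub>S\<close> is singular. Since \<open>S \<mapsto> g\<^sub>S\<close> extends to a map on \<open>V\<^sub>\<tau>\<close> that commutes with the symmetric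
  group, the remaining terms are the image under \<open>\<rho>\<close> of the vector-valued Dunkl operator applied
  to \<open>f \<otimes> S\<close>. Equivariance is given by (I)-(IV) for adjacent transpositions and follows for the
  others by conjugation.\<close>

section \<open>Finitely supported maps\<close>

text \<open>Replaces the update in \<open>update_induct\<close> by the addition of a term with a new
  key, the form to which additivity applies. It serves for polynomials, exponent vectors and vectors
  of \<open>V\<close>.\<close>

lemma poly_mapping_induct_add [case_names zero add]:
  assumes "P 0"
    and "\<And>f k c. k \<notin> Poly_Mapping.keys f \<Longrightarrow> c \<noteq> 0 \<Longrightarrow> P f \<Longrightarrow> P (f + Poly_Mapping.single k c)"
  shows "P (f :: 'k \<Rightarrow>\<^sub>0 'c::comm_monoid_add)"
proof (induction f rule: update_induct)
  case const
  then show ?case by (fact assms(1))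
next
  case (update f k c)
  have "Poly_Mapping.update k c f = f + Poly_Mapping.single k c"
    using update(1)
    by (intro poly_mapping_eqI)
       (auto simp: lookup_update lookup_add lookup_single when_def in_keys_iff)
  then show ?case using assms(2) update by metis
qed

lemma lookup_pm_scale [simp]: "Poly_Mapping.lookup (c \<odot> v) k = c * Poly_Mapping.lookup v k"
  unfolding pm_scale_def by (simp add: Poly_Mapping.map.rep_eq when_def)

lemma pm_scale_single: "c \<odot> Poly_Mapping.single k a = Poly_Mapping.single k (c * a)"
  by (rule poly_mapping_eqI) (simp add: lookup_single when_def)

text \<open>Turns scalar multiplication into a ring product, which \<open>algebra_simps\<close> can
  handle.\<close>

lemma pm_scale_conv_mult: "c \<odot> (p :: 'f::field_char_0 mpoly) = Const c * p"
  unfolding pm_scale_def Const_def by (rule mult_map_scale_conv_mult)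

lemma keys_pm_scale: "Poly_Mapping.keys (c \<odot> v) \<subseteq> Poly_Mapping.keys v"
  by (auto simp: in_keys_iff)

lemma extend_zero [simp]: "extend F 0 = 0"
  unfolding extend_def by simp

text \<open>\<open>extend\<close> sums over the support, which can shrink when terms cancel;
  \<open>F 0 S = 0\<close> lets all three sums run over a common set of keys.\<close>

lemma extend_add:
  assumes "\<And>S. F 0 S = 0" "\<And>f h S. F (f + h) S = F f S + F h S"
  shows "extend F (p + q) = extend F p + extend F q"
  unfolding extend_def using assms by (intro setsum_keys_plus_distrib) auto

lemma extend_single:
  assumes "F 0 S = 0"
  shows "extend F (Poly_Mapping.single S f) = F f S"
  unfolding extend_def using assms by simp

section \<open>Operators on polynomials\<close>

lemma inj_map_key:
  assumes "bij w"
  shows "inj (Poly_Mapping.map_key w :: (nat \<Rightarrow>\<^sub>0 nat) \<Rightarrow> (nat \<Rightarrow>\<^sub>0 nat))"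
proof (rule injI, rule poly_mapping_eqI)
  fix m m' :: "nat \<Rightarrow>\<^sub>0 nat" and k
  assume "Poly_Mapping.map_key w m = Poly_Mapping.map_key w m'"
  then have "Poly_Mapping.lookup m (w l) = Poly_Mapping.lookup m' (w l)" for l
    using bij_is_inj[OF assms] by (metis comp_apply map_key.rep_eq)
  then show "Poly_Mapping.lookup m k = Poly_Mapping.lookup m' k"
    by (metis assms bij_pointE)
qed

text \<open>The exponent vector that \<open>w\<close> pulls back to \<open>m\<close> is
  \<open>m\<close> composed with the inverse of \<open>w\<close>.\<close>

lemma perm_act_single:
  assumes "bij w"
  shows "perm_act w (Poly_Mapping.single m c) =
    Poly_Mapping.single (Poly_Mapping.map_key (inv w) m) c"
proof -
  have "Poly_Mapping.map_key w (Poly_Mapping.map_key (inv w) m) = m"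
    using assms
    by (simp add: map_key_compose bij_is_inj bij_is_surj surj_imp_inj_inv inv_o_cancel
        map_key_id[unfolded id_def[symmetric]])
  then show ?thesis
    unfolding perm_act_def using map_key_single[OF inj_map_key[OF assms]] by metis
qed

lemma perm_act_zero [simp]: "bij w \<Longrightarrow> perm_act w 0 = 0"
  unfolding perm_act_def by (simp add: inj_map_key)

lemma perm_act_add: "bij w \<Longrightarrow> perm_act w (p + q) = perm_act w p + perm_act w q"
  unfolding perm_act_def by (simp add: inj_map_key map_key_plus)

lemma perm_act_sum: "bij w \<Longrightarrow> perm_act w (sum h A) = (\<Sum>x\<in>A. perm_act w (h x))"
  by (induction A rule: infinite_finite_induct) (auto simp: perm_act_add)

text \<open>By biadditivity two monomials suffice, and there \<open>map_key\<close> is additive on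
  exponents.\<close>

lemma perm_act_mult:
  assumes "bij w"
  shows "perm_act w (p * q) = perm_act w p * perm_act w (q :: 'f::field_char_0 mpoly)"
proof (induction p rule: poly_mapping_induct_add)
  case zero
  then show ?case using assms by simp
next
  case (add p m a)
  have "perm_act w (Poly_Mapping.single m a * q) =
      perm_act w (Poly_Mapping.single m a) * perm_act w q"
  proof (induction q rule: poly_mapping_induct_add)
    case zero
    then show ?case using assms by simp
  next
    case (add q n b)
    have "perm_act w (Poly_Mapping.single m a * Poly_Mapping.single n b) =
        perm_act w (Poly_Mapping.single m a) * perm_act w (Poly_Mapping.single n b)"
      using assms
      by (simp add: perm_act_single mult_single map_key_plus bij_imp_bij_inv bij_is_inj)
    then show ?case using add assms by (simp add: perm_act_add distrib_left)
  qed
  then show ?case using add assms by (simp add: perm_act_add distrib_right)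
qed

lemma perm_act_Const [simp]: "bij w \<Longrightarrow> perm_act w (Const c) = Const c"
  unfolding Const_def by (simp add: perm_act_single bij_imp_bij_inv bij_is_inj)

text \<open>\<open>map_key\<close> reverses composition; \<open>perm_act\<close> nests it twice,
  which restores the order.\<close>

lemma perm_act_comp:
  assumes "bij v" "bij w"
  shows "perm_act (v \<circ> w) p = perm_act v (perm_act w p)"
proof -
  have "Poly_Mapping.map_key w \<circ> Poly_Mapping.map_key v =
      (Poly_Mapping.map_key (v \<circ> w) :: (nat \<Rightarrow>\<^sub>0 nat) \<Rightarrow> (nat \<Rightarrow>\<^sub>0 nat))"
    by (simp add: fun_eq_iff map_key_compose[OF bij_is_inj[OF assms(2)] bij_is_inj[OF assms(1)]])
  then show ?thesis
    using assms unfolding perm_act_def by (simp add: map_key_compose inj_map_key)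
qed

section \<open>Divided differences\<close>

lemma X_neq: "i \<noteq> j \<Longrightarrow> X i \<noteq> (X j :: 'f::field_char_0 mpoly)"
proof
  assume "i \<noteq> j" and "X i = (X j :: 'f mpoly)"
  then have "Poly_Mapping.single i (1::nat) = Poly_Mapping.single j 1"
    unfolding X_def by (metis keys_single singleton_inject zero_neq_one)
  with \<open>i \<noteq> j\<close> show False
    by (metis keys_single singleton_inject zero_neq_one)
qed

text \<open>Existence of the quotient behind \<open>divdiff\<close>. Divisibility survives sums and
  multiplication by a variable, so it spreads from constants to all polynomials.\<close>

lemma diff_dvd_diff_perm_act:
  fixes f :: "'f::field_char_0 mpoly"
  shows "(X i - X j) dvd f - perm_act (transpose i j) f"
proof (induction f rule: poly_mapping_induct_add)
  case zero
  then show ?case by simp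
next
  case (add f m c)
  \<comment> \<open>The difference is \<open>X i - X j\<close>, its negative, or zero.\<close>
  have X: "(X i - X j) dvd X k - (perm_act (transpose i j) (X k) :: 'f mpoly)" for k
    by (cases "k = i \<or> k = j")
       (auto simp: perm_act_X transpose_eq_iff, metis dvd_minus_iff dvd_refl minus_diff_eq)
  have "(X i - X j) dvd Poly_Mapping.single m c - perm_act (transpose i j) (Poly_Mapping.single m c)"
  proof (induction m rule: poly_mapping_induct_add)
    case zero
    show ?case by (simp flip: Const_def)
  next
    case (add m k n)
    \<comment> \<open>The exponent of \<open>X k\<close> is raised by one at a time, so that each
      step multiplies by a single variable.\<close>
    have "(X i - X j) dvd Poly_Mapping.single (m + Poly_Mapping.single k n) c -
        perm_act (transpose i j) (Poly_Mapping.single (m + Poly_Mapping.single k n) c)" for n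
    proof (induction n)
      case 0
      then show ?case using add.IH by simp
    next
      case (Suc n)
      let ?p = "Poly_Mapping.single (m + Poly_Mapping.single k n) c" and ?s = "perm_act (transpose i j)"
      have "m + Poly_Mapping.single k (Suc n) =
          Poly_Mapping.single k 1 + (m + Poly_Mapping.single k n)"
        using single_add[of k 1 n] by (simp add: algebra_simps)
      then have eq: "Poly_Mapping.single (m + Poly_Mapping.single k (Suc n)) c = X k * ?p"
        by (simp add: X_def mult_single)
      \<comment> \<open>Twisted Leibniz identity: \<open>X\<close> handles the first summand, the
        induction hypothesis the second.\<close>
      have "X k * ?p - ?s (X k * ?p) = (X k - ?s (X k)) * ?p + ?s (X k) * (?p - ?s ?p)"
        by (simp add: perm_act_mult algebra_simps)
      then show ?case
        unfolding eq by (metis X Suc dvd_add dvd_mult dvd_mult2)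
    qed
    then show ?case .
  qed
  then have "(X i - X j) dvd (f - perm_act (transpose i j) f) +
      (Poly_Mapping.single m c - perm_act (transpose i j) (Poly_Mapping.single m c))"
    by (intro dvd_add add.IH)
  then show ?case by (simp add: perm_act_add algebra_simps)
qed

text \<open>Uniqueness of the quotient: \<open>X i - X j\<close> is nonzero and can be cancelled.
  Identities for \<open>divdiff\<close> thus reduce to multiplying out.\<close>

lemma divdiff_eqI:
  assumes "i \<noteq> j" and "(X i - X j) * q = f - perm_act (transpose i j) f"
  shows "divdiff i j f = (q :: 'f::field_char_0 mpoly)"
  unfolding divdiff_def
proof (rule the_equality)
  fix q' assume "(X i - X j) * q' = f - perm_act (transpose i j) f"
  then have "(X i - X j) * q' = (X i - X j) * q" using assms by simp
  then show "q' = q" using X_neq[OF assms(1)] by (metis mult_cancel_left right_minus_eq)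
qed (fact assms(2))

lemma divdiff_works:
  assumes "i \<noteq> j"
  shows "(X i - X j) * divdiff i j f = f - perm_act (transpose i j) (f :: 'f::field_char_0 mpoly)"
proof -
  obtain q where "f - perm_act (transpose i j) f = (X i - X j) * q"
    using diff_dvd_diff_perm_act by (metis dvdE)
  then show ?thesis using divdiff_eqI[OF assms] by metis
qed

lemma divdiff_zero: "i \<noteq> j \<Longrightarrow> divdiff i j 0 = 0"
  by (rule divdiff_eqI) simp_all

lemma divdiff_add:
  "i \<noteq> j \<Longrightarrow> divdiff i j (f + h) = divdiff i j f + divdiff i j (h :: 'f::field_char_0 mpoly)"
  by (rule divdiff_eqI) (simp_all add: distrib_left divdiff_works perm_act_add)

text \<open>Of the two forms of this rule, the one with the reflection on \<open>h\<close> is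
  chosen: for \<open>h = g S\<close> the last term then becomes part of the Dunkl operator applied
  to \<open>g S\<close>.\<close>

lemma divdiff_mult:
  assumes "i \<noteq> j"
  shows "divdiff i j (f * h) =
    divdiff i j f * perm_act (transpose i j) h + f * divdiff i j (h :: 'f::field_char_0 mpoly)"
proof (rule divdiff_eqI[OF assms])
  let ?s = "perm_act (transpose i j)"
  have "(X i - X j) * (divdiff i j f * ?s h + f * divdiff i j h) =
      (X i - X j) * divdiff i j f * ?s h + f * ((X i - X j) * divdiff i j h)"
    by (simp add: algebra_simps)
  also have "\<dots> = f * h - ?s (f * h)"
    unfolding divdiff_works[OF assms] by (simp add: perm_act_mult algebra_simps)
  finally show "(X i - X j) * (divdiff i j f * ?s h + f * divdiff i j h) = f * h - ?s (f * h)" .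
qed

section \<open>Partial derivatives\<close>

lemma pdiff_zero [simp]: "pdiff i 0 = 0"
  unfolding pdiff_def by simp

lemma pdiff_add: "pdiff i (f + h) = pdiff i f + pdiff i h"
  unfolding pdiff_def by (rule setsum_keys_plus_distrib) (simp_all add: distrib_left single_add)

lemma pdiff_single:
  "pdiff i (Poly_Mapping.single m c) =
    Poly_Mapping.single (m - Poly_Mapping.single i 1) (of_nat (Poly_Mapping.lookup m i) * c)"
  unfolding pdiff_def by simp

text \<open>Subtraction of exponents truncates at 0; the assumption rules this out at
  \<open>i\<close>.\<close>

lemma minus_single_add:
  fixes m n :: "nat \<Rightarrow>\<^sub>0 nat"
  assumes "Poly_Mapping.lookup m i \<noteq> 0"
  shows "m - Poly_Mapping.single i 1 + n = m + n - Poly_Mapping.single i 1"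
  using assms by (intro poly_mapping_eqI) (auto simp: lookup_add lookup_minus lookup_single when_def)

text \<open>Where truncation occurs, the coefficient produced by \<open>pdiff\<close> is 0, so both
  products can be written with the exponent vector \<open>m + n - ?e\<close>.\<close>

lemma pdiff_mult_single:
  "pdiff i (Poly_Mapping.single m a * Poly_Mapping.single n b) =
    pdiff i (Poly_Mapping.single m a) * Poly_Mapping.single n b +
    Poly_Mapping.single m a * pdiff i (Poly_Mapping.single n (b :: 'f::field_char_0))"
proof -
  let ?e = "Poly_Mapping.single i (1::nat)"
  have 1: "pdiff i (Poly_Mapping.single m a) * Poly_Mapping.single n b =
      Poly_Mapping.single (m + n - ?e) (of_nat (Poly_Mapping.lookup m i) * a * b)"
    by (cases "Poly_Mapping.lookup m i = 0")
       (simp_all add: pdiff_single mult_single minus_single_add del: One_nat_def)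
  have 2: "Poly_Mapping.single m a * pdiff i (Poly_Mapping.single n b) =
      Poly_Mapping.single (m + n - ?e) (of_nat (Poly_Mapping.lookup n i) * a * b)"
    using minus_single_add[of n i m]
    by (cases "Poly_Mapping.lookup n i = 0")
       (simp_all add: pdiff_single mult_single ac_simps del: One_nat_def)
  show ?thesis
    unfolding 1 2 by (simp add: mult_single pdiff_single lookup_add algebra_simps flip: single_add)
qed

lemma pdiff_mult:
  fixes f h :: "'f::field_char_0 mpoly"
  shows "pdiff i (f * h) = pdiff i f * h + f * pdiff i h"
proof (induction f rule: poly_mapping_induct_add)
  case zero
  then show ?case by simp
next
  case (add f m a)
  have "pdiff i (Poly_Mapping.single m a * h) =
      pdiff i (Poly_Mapping.single m a) * h + Poly_Mapping.single m a * pdiff i h"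
    by (induction h rule: poly_mapping_induct_add)
       (simp_all add: pdiff_add pdiff_mult_single algebra_simps)
  then show ?case using add.IH by (simp add: pdiff_add algebra_simps)
qed

section \<open>Dunkl operators\<close>

lemma dunkl_zero [simp]: "dunkl N \<kappa> i 0 = 0"
  unfolding dunkl_def by (simp add: divdiff_zero pm_scale_conv_mult)

lemma dunkl_add: "dunkl N \<kappa> i (f + h) = dunkl N \<kappa> i f + dunkl N \<kappa> i h"
proof -
  have "(\<Sum>j\<in>{1..N} - {i}. divdiff i j (f + h)) =
      (\<Sum>j\<in>{1..N} - {i}. divdiff i j f) + (\<Sum>j\<in>{1..N} - {i}. divdiff i j h)"
    unfolding sum.distrib[symmetric] by (intro sum.cong) (auto intro!: divdiff_add)
  then show ?thesis by (simp add: dunkl_def pdiff_add pm_scale_conv_mult algebra_simps)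
qed

lemma dunkl_mult:
  "dunkl N \<kappa> i (f * h) = pdiff i f * h +
    \<kappa> \<odot> (\<Sum>j\<in>{1..N} - {i}. divdiff i j f * perm_act (transpose i j) h) + f * dunkl N \<kappa> i h"
proof -
  have "(\<Sum>j\<in>{1..N} - {i}. divdiff i j (f * h)) =
      (\<Sum>j\<in>{1..N} - {i}. divdiff i j f * perm_act (transpose i j) h) +
      f * (\<Sum>j\<in>{1..N} - {i}. divdiff i j h)"
    unfolding sum_distrib_left sum.distrib[symmetric]
    by (intro sum.cong) (auto intro!: divdiff_mult)
  then show ?thesis by (simp add: dunkl_def pdiff_mult pm_scale_conv_mult algebra_simps)
qed

section \<open>The map \<open>\<rho>\<close>\<close>

lemma rho_zero [simp]: "rho g 0 = 0"
  unfolding rho_def by simp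

lemma rho_add: "rho g (p + q) = rho g p + rho g q"
  unfolding rho_def by (rule extend_add) (simp_all add: distrib_right)

lemma rho_sum: "rho g (sum h A) = (\<Sum>x\<in>A. rho g (h x))"
  by (induction A rule: infinite_finite_induct) (auto simp: rho_add)

lemma rho_single [simp]: "rho g (Poly_Mapping.single S f) = f * g S"
  unfolding rho_def by (simp add: extend_single)

lemma pm_scale_add: "c \<odot> (u + v) = c \<odot> u + c \<odot> v"
  by (rule poly_mapping_eqI) (simp add: lookup_add distrib_left)

text \<open>The multiplier \<open>c\<close> is a polynomial, so this covers both \<open>X i\<close>
  and \<open>Const \<kappa>\<close> in the vector-valued operators.\<close>

lemma rho_pm_scale: "rho g (c \<odot> p) = c * rho g p"
proof (induction p rule: poly_mapping_induct_add)
  case zero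
  have "c \<odot> (0 :: 'a vpoly) = 0" by (rule poly_mapping_eqI) simp
  then show ?case by simp
next
  case (add p S f)
  then show ?case by (simp add: pm_scale_add rho_add pm_scale_single algebra_simps)
qed

section \<open>Tensors and their images under \<rho>\<close>

lemma lookup_tensor [simp]: "Poly_Mapping.lookup (tensor f v) S = Poly_Mapping.lookup v S \<odot> f"
  unfolding tensor_def
  by (auto simp: Poly_Mapping.map.rep_eq when_def intro!: poly_mapping_eqI)

lemma tensor_eq_pm_scale: "tensor f v = f \<odot> tensor 1 v"
  by (rule poly_mapping_eqI) (simp add: pm_scale_conv_mult mult.commute)

text \<open>Splits off the polynomial factor. What remains, \<open>v\<close> mapped to
  \<open>rho g (tensor 1 v)\<close>, is the linear extension of \<open>g\<close>, and equivariance
  is proved for this map.\<close>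

lemma rho_tensor: "rho g (tensor f v) = f * rho g (tensor 1 v)"
  by (subst tensor_eq_pm_scale) (rule rho_pm_scale)

lemma tensor_zero [simp]: "tensor f 0 = 0"
  by (rule poly_mapping_eqI) (simp add: pm_scale_conv_mult Const_def)

lemma tensor_add: "tensor f (u + v) = tensor f u + tensor f v"
  by (rule poly_mapping_eqI)
     (simp add: lookup_add pm_scale_conv_mult Const_def single_add distrib_right)

lemma tensor_pm_scale: "tensor f (c \<odot> v) = Const c \<odot> tensor f v"
  by (rule poly_mapping_eqI)
     (simp add: pm_scale_conv_mult Const_def mult_single flip: mult.assoc)

lemma tensor_single: "tensor f (Poly_Mapping.single S c) = Poly_Mapping.single S (c \<odot> f)"
  by (rule poly_mapping_eqI)
     (auto simp: lookup_single when_def pm_scale_conv_mult Const_def)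

section \<open>Equivariance on the generators\<close>

text \<open>Row lengths decrease weakly, so the diagram is closed under moving up and left.\<close>

lemma boxes_downward:
  assumes "is_partition N tau" "(r, c) \<in> boxes tau" "1 \<le> r'" "r' \<le> r" "1 \<le> c'" "c' \<le> c"
  shows "(r', c') \<in> boxes tau"
proof -
  have "tau ! (r - 1) \<le> tau ! (r' - 1)"
  proof (cases "r' = r")
    case False
    then show ?thesis
      using assms sorted_wrt_nth_less[of "(\<ge>)" tau "r' - 1" "r - 1"]
      by (auto simp: is_partition_def boxes_def)
  qed simp
  then show ?thesis using assms by (auto simp: boxes_def)
qed

text \<open>Bijectivity of \<open>S\<close> makes the definite description in \<open>box_of\<close>
  proper.\<close>

lemma box_of_Tab:
  assumes "S \<in> Tab N tau" "k \<in> {1..N}"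
  shows "(row tau S k, col tau S k) \<in> boxes tau" "S (row tau S k, col tau S k) = k"
proof -
  have inj: "inj_on S (boxes tau)" and img: "S ` boxes tau = {1..N}"
    using assms(1) by (simp_all add: Tab_def bij_betw_def)
  obtain x where x: "x \<in> boxes tau" "S x = k"
    using assms(2) unfolding img[symmetric] by auto
  then have "\<exists>!x. x \<in> boxes tau \<and> S x = k"
    using inj_onD[OF inj] by (intro ex1I[of _ x]) simp_all
  from theI'[OF this] show "(row tau S k, col tau S k) \<in> boxes tau" "S (row tau S k, col tau S k) = k"
    by (simp_all add: row_def col_def box_of_def)
qed

text \<open>If the boxes of \<open>i\<close> and \<open>i + 1\<close> were comparable and in different rows and columns, the
  entry at a third corner of the rectangle they span would lie strictly between \<open>i\<close> and \<open>i + 1\<close>.\<close>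

lemma Tab_consecutive_cases:
  assumes "is_partition N tau" "S \<in> Tab N tau" "1 \<le> i" "i < N"
  obtains "row tau S i = row tau S (i + 1)" | "col tau S i = col tau S (i + 1)"
    | "row tau S i < row tau S (i + 1)" "col tau S i > col tau S (i + 1)"
    | "row tau S i > row tau S (i + 1)" "col tau S i < col tau S (i + 1)"
proof -
  have "i \<in> {1..N}" "i + 1 \<in> {1..N}" using assms by auto
  note b = box_of_Tab[OF assms(2) this(1)] box_of_Tab[OF assms(2) this(2)]
  have rows: "S (r, c) > S (r, c')" if "(r, c) \<in> boxes tau" "(r, c') \<in> boxes tau" "c < c'" for r c c'
    using assms(2) that unfolding Tab_def by blast
  have cols: "S (r, c) > S (r', c)" if "(r, c) \<in> boxes tau" "(r', c) \<in> boxes tau" "r < r'" for r r' c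
    using assms(2) that unfolding Tab_def by blast
  have ge1: "1 \<le> r" "1 \<le> c" if "(r, c) \<in> boxes tau" for r c
    using that by (auto simp: boxes_def)
  \<comment> \<open>The bound with \<open>+ 1\<close> serves both placements of \<open>i\<close> and
    \<open>i + 1\<close>: the corner \<open>(r, c')\<close> forces a drop of at least 2.\<close>
  have nw: False if "(r, c) \<in> boxes tau" "(r', c') \<in> boxes tau" "r < r'" "c < c'"
      "S (r, c) \<le> S (r', c') + 1" for r c r' c'
  proof -
    have "(r, c') \<in> boxes tau"
      using boxes_downward[OF assms(1) that(2)] ge1[OF that(1)] ge1[OF that(2)] that(3) by auto
    then have "S (r, c) > S (r, c')" "S (r, c') > S (r', c')" using rows cols that by blast+
    then show False using that(5) by linarith
  qed
  have "\<not> (row tau S i < row tau S (i + 1) \<and> col tau S i < col tau S (i + 1))"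
    using nw[OF b(1) b(3)] by (auto simp: b(2) b(4)[simplified])
  moreover have "\<not> (row tau S (i + 1) < row tau S i \<and> col tau S (i + 1) < col tau S i)"
    using nw[OF b(3) b(1)] by (auto simp: b(2) b(4)[simplified])
  ultimately show thesis
    using that by (meson linorder_neqE_nat)
qed

text \<open>\<open>A\<close> and \<open>B\<close> obey the same formulas with the same coefficients,
  and the linear extension of \<open>g\<close> carries one set to the other, case by case.\<close>

lemma rho_tensor_adjacent_transposition:
  fixes g :: "tableau \<Rightarrow> 'f::field_char_0 mpoly"
  assumes "is_partition N tau" "S \<in> Tab N tau" "1 \<le> i" "i < N"
    and R: "seminormal_action N tau pm_scale tab_basis A"
    and g: "seminormal_action N tau pm_scale g B"
  shows "rho g (tensor 1 (A i (tab_basis S))) = B i (g S)"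
proof -
  define b where "b = content tau S i - content tau S (i + 1)"
  note R' = R[unfolded seminormal_action_def Let_def, rule_format, OF assms(2), of i, folded b_def]
  note g' = g[unfolded seminormal_action_def Let_def, rule_format, OF assms(2), of i, folded b_def]
  \<comment> \<open>Stated for every filling \<open>T\<close>, so that it also evaluates at
    \<open>exchange i S\<close>.\<close>
  have ev: "rho g (tensor 1 (tab_basis T)) = g T" for T
    by (simp add: tensor_single pm_scale_conv_mult Const_def)
  have lin: "rho g (tensor 1 (u + v)) = rho g (tensor 1 u) + rho g (tensor 1 v)"
      "rho g (tensor 1 (c \<odot> v)) = c \<odot> rho g (tensor 1 v)" for u v c
    by (simp_all add: tensor_add rho_add tensor_pm_scale rho_pm_scale pm_scale_conv_mult)
  have "- tab_basis S = (-1 :: 'f) \<odot> tab_basis S"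
    by (rule poly_mapping_eqI) simp
  then have "rho g (tensor 1 (- tab_basis S)) = (-1) \<odot> g S"
    by (simp only: lin(2) ev)
  also have "\<dots> = - g S" by (rule poly_mapping_eqI) simp
  finally have uminus: "rho g (tensor 1 (- tab_basis S)) = - g S" .
  show ?thesis
  proof (rule Tab_consecutive_cases[OF assms(1-4)])
    assume "row tau S i = row tau S (i + 1)"
    then show ?thesis using R' g' assms(3,4) by (simp add: ev)
  next
    assume "col tau S i = col tau S (i + 1)"
    then show ?thesis using R' g' assms(3,4) by (simp add: uminus)
  next
    assume "row tau S i < row tau S (i + 1)" "col tau S i > col tau S (i + 1)"
    then show ?thesis using R' g' assms(3,4) by (simp add: lin ev)
  next
    assume "row tau S i > row tau S (i + 1)" "col tau S i < col tau S (i + 1)"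
    \<comment> \<open>The column difference is at most -1 and the row difference at least 1, which
      is how (IV) arises.\<close>
    then have "b \<le> -2" by (simp add: b_def content_def)
    then show ?thesis using R' g' assms(3,4) by (simp add: lin ev)
  qed
qed

section \<open>From adjacent transpositions to all transpositions\<close>

lemma tab_basis_in_V: "S \<in> Tab N tau \<Longrightarrow> tab_basis S \<in> V N tau"
  by (simp add: V_def)

lemma zero_in_V: "0 \<in> V N tau"
  by (simp add: V_def)

lemma pm_scale_in_V: "v \<in> V N tau \<Longrightarrow> c \<odot> v \<in> V N tau"
  using keys_pm_scale[of c v] unfolding V_def by auto

text \<open>Conjugation applies \<open>R\<close> to vectors that are not basis tableaux, hence the
  extension to all of \<open>V N tau\<close>. Since \<open>R w\<close> is linear only there, the
  induction carries membership along.\<close>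

lemma rho_tensor_rep_linear:
  assumes R: "young_rep N tau R" and w: "w permutes {1..N}"
    and basis: "\<And>S. S \<in> Tab N tau \<Longrightarrow> rho g (tensor 1 (R w (tab_basis S))) = perm_act w (g S)"
    and v: "v \<in> V N tau"
  shows "rho g (tensor 1 (R w v)) = perm_act w (rho g (tensor 1 v))"
  using v
proof (induction v rule: poly_mapping_induct_add)
  have bij: "bij w" using w by (rule permutes_bij)
  have R_add: "R w (u + v) = R w u + R w v" if "u \<in> V N tau" "v \<in> V N tau" for u v
    using R w that unfolding young_rep_def by blast
  have R_scale: "R w (c \<odot> v) = c \<odot> R w v" if "v \<in> V N tau" for c v
    using R w that unfolding young_rep_def by blast
  {
    case zero
    have "R w 0 = 0" using R_add[OF zero_in_V zero_in_V] by simp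
    then show ?case using bij by simp
  next
    case (add v S c)
    \<comment> \<open>A new key cancels nothing, so membership of the sum in \<open>V N tau\<close>
      passes to both summands.\<close>
    have "Poly_Mapping.keys (v + Poly_Mapping.single S c) = insert S (Poly_Mapping.keys v)"
      using add(1,2) by (auto simp: in_keys_iff lookup_add lookup_single when_def split: if_splits)
    then have S: "S \<in> Tab N tau" and v: "v \<in> V N tau" using add.prems by (auto simp: V_def)
    have c: "Poly_Mapping.single S c = c \<odot> tab_basis S" by (simp add: pm_scale_single)
    note V = tab_basis_in_V[OF S]
    have "rho g (tensor 1 (R w (c \<odot> tab_basis S))) = perm_act w (rho g (tensor 1 (c \<odot> tab_basis S)))"
      using bij
      by (simp add: R_scale[OF V] tensor_pm_scale rho_pm_scale basis[OF S] tensor_single perm_act_mult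
          pm_scale_conv_mult Const_def perm_act_Const[unfolded Const_def])
    then show ?case
      using bij add.IH[OF v]
      by (simp add: c R_add[OF v pm_scale_in_V[OF V]] tensor_add rho_add perm_act_add)
  }
qed

lemma rho_tensor_transposition:
  assumes part: "is_partition N tau" and R: "young_rep N tau R" and g: "isotype_basis N tau g"
    and "i \<in> {1..N}" "j \<in> {1..N}" "i \<noteq> j" "v \<in> V N tau"
  shows "rho g (tensor 1 (R (transpose i j) v)) = perm_act (transpose i j) (rho g (tensor 1 v))"
proof -
  have adj: "rho g (tensor 1 (R (transpose i (i + 1)) v)) = perm_act (transpose i (i + 1)) (rho g (tensor 1 v))"
    if "1 \<le> i" "i < N" "v \<in> V N tau" for i v
  proof (rule rho_tensor_rep_linear[OF R _ _ that(3)])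
    show "transpose i (i + 1) permutes {1..N}" using that by (intro permutes_swap_id) auto
    show "rho g (tensor 1 (R (transpose i (i + 1)) (tab_basis S))) = perm_act (transpose i (i + 1)) (g S)"
      if "S \<in> Tab N tau" for S
      using rho_tensor_adjacent_transposition[OF part that \<open>1 \<le> i\<close> \<open>i < N\<close>,
          of "\<lambda>i. R (transpose i (i + 1))" g "\<lambda>i. perm_act (transpose i (i + 1))"] R g
      unfolding young_rep_def isotype_basis_def by blast
  qed
  have R_V: "R w v \<in> V N tau" if "w permutes {1..N}" "v \<in> V N tau" for w v
    using R that unfolding young_rep_def by blast
  have R_comp: "R (p \<circ> s) v = R p (R s v)"
    if "p permutes {1..N}" "s permutes {1..N}" "v \<in> V N tau" for p s v
    using R that unfolding young_rep_def by blast
  \<comment> \<open>Induction on the larger index; \<open>v\<close> is arbitrary because the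
    hypothesis is applied to \<open>R ?s v\<close>.\<close>
  have less: "rho g (tensor 1 (R (transpose i j) v)) = perm_act (transpose i j) (rho g (tensor 1 v))"
    if "i < j" "1 \<le> i" "j \<le> N" "v \<in> V N tau" for i j v
    using that
  proof (induction j arbitrary: v rule: less_induct)
    case (less j)
    show ?case
    proof (cases "j = i + 1")
      case True
      then show ?thesis using adj[of i v] less.prems by simp
    next
      case False
      define k where "k = j - 1"
      have k: "j = k + 1" "i < k" "k < N" using False less.prems by (auto simp: k_def)
      let ?s = "transpose k (k + 1)" and ?t = "transpose i k"
      have perm: "?s permutes {1..N}" "?t permutes {1..N}"
        using k less.prems by (auto intro!: permutes_swap_id)
      have conj: "transpose i j = ?s \<circ> (?t \<circ> ?s)"
        using k by (auto simp: fun_eq_iff transpose_def)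
      have perm2: "?t \<circ> ?s permutes {1..N}" using perm by (intro permutes_compose)
      \<comment> \<open>\<open>R\<close> and \<open>perm_act\<close> split the composite in the same
        order, so the adjacent, inductive and adjacent cases chain.\<close>
      have "R (transpose i j) v = R ?s (R ?t (R ?s v))"
        unfolding conj using R_comp perm perm2 less.prems by metis
      moreover have "perm_act (transpose i j) p = perm_act ?s (perm_act ?t (perm_act ?s p))" for p :: "'a mpoly"
        unfolding conj by (simp add: perm_act_comp bij_comp)
      ultimately show ?thesis
        using k less.prems less.IH[of k "R ?s v"] adj[of k v] adj[of k "R ?t (R ?s v)"] R_V perm by simp
    qed
  qed
  show ?thesis
    using less[of i j v] less[of j i v] assms(4-) by (cases "i < j") (auto simp: transpose_commute)
qed

section \<open>Intertwining\<close>

text \<open>The one place where singularity enters, which ties the parameter to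
  \<open>\<kappa>\<^sub>0\<close>.\<close>

lemma rho_vdunkl_single:
  assumes part: "is_partition N tau" and R: "young_rep N tau R" and SP: "property_SP N tau \<kappa>\<^sub>0 g"
    and i: "i \<in> {1..N}" and S: "S \<in> Tab N tau"
  shows "rho g (tensor (pdiff i f) (tab_basis S) + Const (of_rat \<kappa>\<^sub>0) \<odot>
      (\<Sum>j\<in>{1..N} - {i}. tensor (divdiff i j f) (R (transpose i j) (tab_basis S)))) =
    dunkl N (of_rat \<kappa>\<^sub>0) i (f * g S)"
proof -
  have iso: "isotype_basis N tau g" and sing: "dunkl N (of_rat \<kappa>\<^sub>0) i (g S) = 0"
    using SP i S by (auto simp: property_SP_def singular_def)
  have "rho g (tensor (divdiff i j f) (R (transpose i j) (tab_basis S))) =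
      divdiff i j f * perm_act (transpose i j) (g S)" if "j \<in> {1..N} - {i}" for j
    using that i rho_tensor_transposition[OF part R iso i, of j, OF _ _ tab_basis_in_V[OF S]]
    by (subst rho_tensor) (auto simp: tensor_single pm_scale_conv_mult Const_def)
  then show ?thesis
    by (simp add: rho_add rho_pm_scale rho_sum dunkl_mult sing tensor_single pm_scale_conv_mult
        Const_def)
qed

text \<open>Equivariance suffices here, because \<open>perm_act\<close> is multiplicative on
  \<open>f * g S\<close>.\<close>

lemma rho_vjucys_murphy_single:
  assumes part: "is_partition N tau" and R: "young_rep N tau R" and iso: "isotype_basis N tau g"
    and i: "i \<in> {1..N}" and S: "S \<in> Tab N tau"
  shows "rho g (\<Sum>j\<in>{i<..N}. tensor (perm_act (transpose i j) f) (R (transpose i j) (tab_basis S))) =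
    jucys_murphy N i (f * g S)"
proof -
  have "rho g (tensor (perm_act (transpose i j) f) (R (transpose i j) (tab_basis S))) =
      perm_act (transpose i j) (f * g S)" if "j \<in> {i<..N}" for j
    using that i rho_tensor_transposition[OF part R iso i, of j, OF _ _ tab_basis_in_V[OF S]]
    by (subst rho_tensor) (auto simp: tensor_single pm_scale_conv_mult Const_def perm_act_mult)
  then show ?thesis by (simp add: rho_sum jucys_murphy_def)
qed

theorem proposition3p6:
  fixes N :: nat and tau :: "nat list" and \<iota> :: "complex \<Rightarrow> 'f::field_char_0"
    and R :: "(nat \<Rightarrow> nat) \<Rightarrow> (tableau \<Rightarrow>\<^sub>0 'f) \<Rightarrow> (tableau \<Rightarrow>\<^sub>0 'f)"
    and g :: "tableau \<Rightarrow> 'f mpoly" and \<kappa>\<^sub>0 :: rat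
  assumes "N \<ge> 2" and "is_partition N tau"
    and "complex_embedding \<iota>"
    and "young_rep N tau R"
    and "property_SP N tau \<kappa>\<^sub>0 g"
  shows "\<forall>i\<in>{1..N}. \<forall>p\<in>Pol_tau N tau.
           rho g (vdunkl R N (of_rat \<kappa>\<^sub>0) i p) = dunkl N (of_rat \<kappa>\<^sub>0) i (rho g p) \<and>
           rho g (vcherednik R N (of_rat \<kappa>\<^sub>0) i p) = cherednik N (of_rat \<kappa>\<^sub>0) i (rho g p)"
proof (intro ballI conjI)
  fix i and p :: "'f vpoly" assume i: "i \<in> {1..N}" and p: "p \<in> Pol_tau N tau"
  let ?D = "dunkl N (of_rat \<kappa>\<^sub>0) i"
  have iso: "isotype_basis N tau g" using assms(5) by (simp add: property_SP_def)
  have S: "S \<in> Tab N tau" if "S \<in> Poly_Mapping.keys p" for S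
    using p that by (auto simp: Pol_tau_def)
  have rho_p: "rho g p = (\<Sum>S\<in>Poly_Mapping.keys p. Poly_Mapping.lookup p S * g S)"
    by (simp add: rho_def extend_def)
  have D_sum: "?D (sum h A) = (\<Sum>S\<in>A. ?D (h S))" for h and A :: "tableau set"
    by (induction A rule: infinite_finite_induct) (simp_all add: dunkl_add)
  have JM_sum: "jucys_murphy N i (sum h A) = (\<Sum>S\<in>A. jucys_murphy N i (h S))"
    for h :: "tableau \<Rightarrow> 'f mpoly" and A
    unfolding jucys_murphy_def by (simp add: perm_act_sum) (rule sum.swap)
  \<comment> \<open>Both sides become sums over the keys of \<open>p\<close> and are compared
    summand by summand.\<close>
  show D: "rho g (vdunkl R N (of_rat \<kappa>\<^sub>0) i p) = ?D (rho g p)"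
    unfolding rho_p D_sum vdunkl_def
    by (subst extend_def, subst rho_sum)
       (intro sum.cong refl rho_vdunkl_single[OF assms(2,4,5) i] S)
  have JM: "rho g (vjucys_murphy R N i p) = jucys_murphy N i (rho g p)"
    unfolding rho_p JM_sum vjucys_murphy_def
    by (subst extend_def, subst rho_sum)
       (intro sum.cong refl rho_vjucys_murphy_single[OF assms(2,4) iso i] S)
  show "rho g (vcherednik R N (of_rat \<kappa>\<^sub>0) i p) = cherednik N (of_rat \<kappa>\<^sub>0) i (rho g p)"
    by (simp add: vcherednik_def cherednik_def rho_add rho_pm_scale D JM pm_scale_conv_mult)
qed

end
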